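(* Let $g_1,\dots,g_m\in\mathbb{R}[\mathbf{x}]$ be nonzero polynomials in $d$ variables, let $S=\{\mathbf{x}\in\mathbb{R}^d: g_j(\mathbf{x})\ge0,\ j=1,\dots,m\}$ be compact with nonempty interior, and suppose $g_1(\mathbf{x})=M-\|\mathbf{x}\|^2$ for some $M>0$. Set $g_0=1$, $r_j=\lceil\deg(g_j)/2\rceil$ for $j=0,\dots,m$, and let $n\in\mathbb{N}$ with $n\ge\max_j r_j$. Then every optimal solution $\mu\in\mathscr{P}(S)$ of $$\max_{\phi\in\mathscr{P}(S)}\ \sum_{j=0}^m\log\det\mathbf{M}_{n-r_j}(g_j\,\phi)$$ satisfies $$\sum_{j=0}^m s_{n-r_j}-\sum_{j=0}^m g_j(\mathbf{x})\,K^{g_j\mu}_{n-r_j}(\mathbf{x},\mathbf{x})\ \ge\ 0\,,\qquad\forall\,\mathbf{x}\in S,$$ $$\sum_{j=0}^m s_{n-r_j}-\sum_{j=0}^m g_j(\mathbf{x})\,K^{g_j\mu}_{n-r_j}(\mathbf{x},\mathbf{x})\ =\ 0\,,\qquad\mu\text{-a.e.}$$ In addition, if $\mu=f\,d\mathbf{x}$ with $f>0$ on $S$ is an optimal solution, then $$\sum_{j=0}^m s_{n-r_j}\,=\,\sum_{j=0}^m g_j(\mathbf{x})\,K^{g_j\mu}_{n-r_j}(\mathbf{x},\mathbf{x})\,,\qquad\forall\,\mathbf{x}\in\mathbb{R}^d.$$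
   Context: $\mathscr{P}(S)$ is the set of Borel probability measures on $S$. $s_k=\binom{k+d}{d}$, and $\mathbf{v}_k(\mathbf{x})=(\mathbf{x}^{\boldsymbol{\alpha}})_{|\boldsymbol{\alpha}|\le k}$ is the vector of all monomials in $x_1,\dots,x_d$ of total degree at most $k$. For a measure $\phi$ on $S$ and a polynomial $g$, $g\phi$ denotes the measure with density $g$ with respect to $\phi$, and $\mathbf{M}_k(g\,\phi)=\int_S\mathbf{v}_k(\mathbf{x})\mathbf{v}_k(\mathbf{x})^T g(\mathbf{x})\,d\phi(\mathbf{x})$. When this matrix is positive definite, $K^{g\phi}_k(\mathbf{x},\mathbf{y})=\mathbf{v}_k(\mathbf{x})^T\mathbf{M}_k(g\,\phi)^{-1}\mathbf{v}_k(\mathbf{y})$ is the associated Christoffel–Darboux kernel. Convention: $\log\det\mathbf{X}=-\infty$ for singular $\mathbf{X}\succeq0$. In "$\mu=f\,d\mathbf{x}$", $d\mathbf{x}$ is Lebesgue measure restricted to $S$. *)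

theory Defs
  imports
    "HOL-Probability.Probability"
    "HOL-Library.Poly_Mapping"
    "Jordan_Normal_Form.Gauss_Jordan_Elimination"
    "Jordan_Normal_Form.Determinant"
begin

text \<open>
  Real polynomials in the variables \<open>x $ i\<close>, \<open>i :: 'd\<close>, are finitely supported maps from
  multi-indices to coefficients; \<open>0\<close> and \<open>1\<close> are those of the polynomial ring.
  The number of variables is \<open>CARD('d)\<close>.
\<close>

type_synonym 'd multi_index = "'d \<Rightarrow>\<^sub>0 nat"
type_synonym 'd polynomial = "'d multi_index \<Rightarrow>\<^sub>0 real"

definition mi_degree :: "'d::finite multi_index \<Rightarrow> nat" where
  "mi_degree \<alpha> = (\<Sum>i\<in>UNIV. Poly_Mapping.lookup \<alpha> i)"

definition monomial_eval :: "'d::finite multi_index \<Rightarrow> real ^ 'd \<Rightarrow> real" where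
  "monomial_eval \<alpha> x = (\<Prod>i\<in>UNIV. vec_nth x i ^ Poly_Mapping.lookup \<alpha> i)"

definition poly_eval :: "'d::finite polynomial \<Rightarrow> real ^ 'd \<Rightarrow> real" where
  "poly_eval p x = (\<Sum>\<alpha>\<in>Poly_Mapping.keys p. Poly_Mapping.lookup p \<alpha> * monomial_eval \<alpha> x)"

definition total_degree :: "'d::finite polynomial \<Rightarrow> nat" where
  "total_degree p = Max (insert 0 (mi_degree ` Poly_Mapping.keys p))"

definition half_degree :: "'d::finite polynomial \<Rightarrow> nat" where
  "half_degree p = nat \<lceil>real (total_degree p) / 2\<rceil>"

text \<open>
  Matrices whose size depends on \<open>k\<close> are those of \<open>Jordan_Normal_Form\<close>, indexed by initial
  segments of the naturals. Hence the monomials of degree at most \<open>k\<close> are listed in an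
  arbitrary fixed order. Determinants of moment matrices and Christoffel--Darboux kernels do not
  depend on it.
\<close>

definition mi_list :: "nat \<Rightarrow> 'd::finite multi_index list" where
  "mi_list k = (SOME l. distinct l \<and> set l = {\<alpha>. mi_degree \<alpha> \<le> k})"

lemma finite_mi_degree_le: "finite {\<alpha> :: 'd::finite multi_index. mi_degree \<alpha> \<le> k}"
proof -
  have "Poly_Mapping.lookup \<alpha> \<in> PiE UNIV (\<lambda>_. {..k})"
    if "mi_degree \<alpha> \<le> k" for \<alpha> :: "'d multi_index"
  proof (rule PiE_I)
    fix i
    have "Poly_Mapping.lookup \<alpha> i \<le> mi_degree \<alpha>"
      unfolding mi_degree_def by (rule member_le_sum) simp_all
    with that show "Poly_Mapping.lookup \<alpha> i \<in> {..k}"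
      unfolding atMost_iff by (rule order_trans[rotated])
  qed simp
  then have "Poly_Mapping.lookup ` {\<alpha> :: 'd multi_index. mi_degree \<alpha> \<le> k} \<subseteq> PiE UNIV (\<lambda>_. {..k})"
    by blast
  moreover have "finite (PiE (UNIV :: 'd set) (\<lambda>_. {..k}))"
    by (rule finite_PiE) simp_all
  ultimately have "finite (Poly_Mapping.lookup ` {\<alpha> :: 'd multi_index. mi_degree \<alpha> \<le> k})"
    by (rule finite_subset)
  moreover have "inj_on Poly_Mapping.lookup {\<alpha> :: 'd multi_index. mi_degree \<alpha> \<le> k}"
    by (rule inj_onI) (rule poly_mapping_eqI, rule fun_cong)
  ultimately show ?thesis
    by (rule finite_imageD)
qed

lemma mi_list:
  shows distinct_mi_list: "distinct (mi_list k :: 'd::finite multi_index list)"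
    and set_mi_list: "set (mi_list k) = {\<alpha> :: 'd multi_index. mi_degree \<alpha> \<le> k}"
proof -
  have "\<exists>l. distinct l \<and> set l = {\<alpha> :: 'd multi_index. mi_degree \<alpha> \<le> k}"
    using finite_distinct_list[OF finite_mi_degree_le, of k] by blast
  from someI_ex[OF this]
  show "distinct (mi_list k :: 'd multi_index list)"
    and "set (mi_list k) = {\<alpha> :: 'd multi_index. mi_degree \<alpha> \<le> k}"
    by (simp_all add: mi_list_def)
qed

definition monomial_count :: "nat \<Rightarrow> nat \<Rightarrow> nat" where
  "monomial_count d k = (k + d) choose d"

definition monomial_vec :: "nat \<Rightarrow> real ^ 'd::finite \<Rightarrow> real Matrix.vec" where
  "monomial_vec k x = vec_of_list (map (\<lambda>\<alpha>. monomial_eval \<alpha> x) (mi_list k))"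

text \<open>
  In \<open>moment_matrix k g \<phi>\<close> the measure is \<open>g \<phi>\<close>, the weight \<open>g\<close> being written
  into the integrand.
\<close>

definition moment_matrix ::
    "nat \<Rightarrow> 'd::finite polynomial \<Rightarrow> (real ^ 'd) measure \<Rightarrow> real mat" where
  "moment_matrix k g \<phi> =
     Matrix.mat (length (mi_list k :: 'd multi_index list)) (length (mi_list k :: 'd multi_index list))
       (\<lambda>(i, j). \<integral>x. vec_index (monomial_vec k x) i * vec_index (monomial_vec k x) j
                        * poly_eval g x \<partial>\<phi>)"

text \<open>Only meaningful when the moment matrix is invertible.\<close>

definition cd_kernel ::
    "nat \<Rightarrow> 'd::finite polynomial \<Rightarrow> (real ^ 'd) measure \<Rightarrow> real ^ 'd \<Rightarrow> real ^ 'd \<Rightarrow> real" where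
  "cd_kernel k g \<phi> x y =
     scalar_prod (monomial_vec k x)
       (mult_mat_vec (the (mat_inverse (moment_matrix k g \<phi>))) (monomial_vec k y))"

text \<open>For positive semidefinite \<open>X\<close>, the determinant is positive iff \<open>X\<close> is nonsingular.\<close>

definition log_det :: "real mat \<Rightarrow> ereal" where
  "log_det X = (if Determinant.det X > 0 then ereal (ln (Determinant.det X)) else -\<infinity>)"

definition semialg_set :: "nat \<Rightarrow> (nat \<Rightarrow> 'd::finite polynomial) \<Rightarrow> (real ^ 'd) set" where
  "semialg_set m g = {x. \<forall>j\<in>{1..m}. poly_eval (g j) x \<ge> 0}"

definition borel_prob_measures :: "'a::topological_space set \<Rightarrow> 'a measure set" where
  "borel_prob_measures S = {\<phi>. sets \<phi> = sets (restrict_space borel S) \<and> prob_space \<phi>}"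

definition log_det_objective ::
    "nat \<Rightarrow> (nat \<Rightarrow> 'd::finite polynomial) \<Rightarrow> nat \<Rightarrow> (real ^ 'd) measure \<Rightarrow> ereal" where
  "log_det_objective m g n \<phi> =
     (\<Sum>j\<in>{0..m}. log_det (moment_matrix (n - half_degree (g j)) (g j) \<phi>))"

definition optimal_solution ::
    "nat \<Rightarrow> (nat \<Rightarrow> 'd::finite polynomial) \<Rightarrow> nat \<Rightarrow> (real ^ 'd) measure \<Rightarrow> bool" where
  "optimal_solution m g n \<mu> \<longleftrightarrow>
     \<mu> \<in> borel_prob_measures (semialg_set m g) \<and>
     (\<forall>\<phi>\<in>borel_prob_measures (semialg_set m g).
        log_det_objective m g n \<phi> \<le> log_det_objective m g n \<mu>)"

end

theory Submission
  imports Defs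
begin

text \<open>
  Fix \<open>x \<in> S\<close> and move from the optimal measure \<open>\<mu>\<close> a little towards the point mass at \<open>x\<close>. For
  \<open>\<tau> > 0\<close> the measure \<open>\<phi> = (\<mu> + \<tau> \<delta>\<^sub>x) / (1 + \<tau>)\<close> is again a Borel probability measure on \<open>S\<close>
  (\<open>borel_prob_measures_mix_point\<close>), and each moment matrix becomes
  \<open>(M\<^sub>j + \<tau> g\<^sub>j(x) v v\<^sup>T) / (1 + \<tau>)\<close>, where \<open>v\<close> is the monomial vector at \<open>x\<close>. This is a scaled
  rank-one update, so the matrix determinant lemma gives its determinant in closed form
  (\<open>det_moment_matrix_mix_point\<close>), the Christoffel--Darboux kernel entering as \<open>v\<^sup>T M\<^sub>j\<^sup>-\<^sup>1 v\<close>. With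
  \<open>a\<^sub>j = g\<^sub>j(x) K\<^sub>j(x, x)\<close> and \<open>N\<close> the sum of the matrix sizes, optimality of \<open>\<mu>\<close> reads
  \<open>\<Sum>\<^sub>j ln (1 + \<tau> a\<^sub>j) \<le> N ln (1 + \<tau>)\<close> for all \<open>\<tau> > 0\<close>. Both sides vanish at \<open>\<tau> = 0\<close>; comparing
  derivatives there yields \<open>\<Sum>\<^sub>j a\<^sub>j \<le> N\<close> (\<open>sum_le_of_sum_ln_le\<close>), which is the claimed inequality.

  For this the moment matrices of \<open>\<mu>\<close> have to be nonsingular. The uniform distribution on \<open>S\<close> is a
  competitor with finite objective value: its moment matrices are positive definite, because a
  polynomial vanishing on an open set is zero and distinct monomials are linearly independent
  (\<open>moment_matrix_uniform_det_pos\<close>). So the maximum is finite, and no determinant at \<open>\<mu>\<close> is zero.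

  The \<open>\<mu>\<close>-integral of \<open>g\<^sub>j(x) K\<^sub>j(x, x)\<close> is the trace of \<open>M\<^sub>j\<^sup>-\<^sup>1 M\<^sub>j\<close>, that is, the size of \<open>M\<^sub>j\<close>
  (\<open>integral_cd_kernel\<close>), which a stars-and-bars count identifies with the binomial coefficient
  (\<open>length_mi_list\<close>). The nonnegative polynomial \<open>N - \<Sum>\<^sub>j g\<^sub>j(x) K\<^sub>j(x, x)\<close> therefore has integral zero
  and vanishes \<open>\<mu>\<close>-almost everywhere. If \<open>\<mu>\<close> has a positive density, it vanishes Lebesgue-almost
  everywhere on \<open>S\<close>, hence on the interior of \<open>S\<close> by continuity, hence identically.
\<close>

text \<open>In what follows \<open>\<bullet>\<close> and \<open>$\<close> belong to the vectors of the moment matrices.\<close>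

unbundle no inner_syntax
no_notation vec_nth (infixl "$" 90)

section \<open>Determinants of rank-one updates and of positive definite matrices\<close>

text \<open>
  Sylvester's determinant identity: both sides are the determinant of the block matrix with rows
  \<open>(1, U)\<close> and \<open>(-W, 1)\<close>. Eliminating \<open>-W\<close> by row operations gives the right-hand side,
  eliminating it by column operations the left-hand side; the same factor \<open>?L\<close> does both.
\<close>

lemma det_one_plus_mult_commute:
  fixes U W :: "'a :: idom mat"
  assumes U: "U \<in> carrier_mat n m" and W: "W \<in> carrier_mat m n"
  shows "Determinant.det (1\<^sub>m n + U * W) = Determinant.det (1\<^sub>m m + W * U)"
proof -
  let ?L = "four_block_mat (1\<^sub>m n) (0\<^sub>m n m) (- W) (1\<^sub>m m)"
  let ?R1 = "four_block_mat (1\<^sub>m n) U (0\<^sub>m m n) (1\<^sub>m m + W * U)"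
  let ?R2 = "four_block_mat (1\<^sub>m n + U * W) U (0\<^sub>m m n) (1\<^sub>m m)"
  have UW: "U * W \<in> carrier_mat n n" "W * U \<in> carrier_mat m m" "- W \<in> carrier_mat m n"
    using U W by auto
  have L: "?L \<in> carrier_mat (n + m) (n + m)" and R1: "?R1 \<in> carrier_mat (n + m) (n + m)"
    and R2: "?R2 \<in> carrier_mat (n + m) (n + m)"
    using UW by (auto intro!: four_block_carrier_mat)
  have c1: "- W * U + (1\<^sub>m m + W * U) = 1\<^sub>m m" 
    using U W UW by (intro eq_matI) (auto simp: uminus_mult_left_mat)
  have c2: "1\<^sub>m n + U * W + U * (- W) = 1\<^sub>m n" 
    using U W UW by (intro eq_matI) (auto simp: uminus_mult_right_mat)
  have e1: "?L * ?R1 = four_block_mat (1\<^sub>m n) U (- W) (1\<^sub>m m)"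
    using U W UW c1
    by (subst mult_four_block_mat[of _ n n _ m _ m _ _ n _ m]) simp_all
  have e2: "?R2 * ?L = four_block_mat (1\<^sub>m n) U (- W) (1\<^sub>m m)"
    using U W UW c2
    by (subst mult_four_block_mat[of _ n n _ m _ m _ _ n _ m]) simp_all
  have "Determinant.det ?L * Determinant.det ?R1 = Determinant.det ?R2 * Determinant.det ?L"
    using det_mult[OF L R1] det_mult[OF R2 L] e1 e2 by simp
  moreover have "Determinant.det ?L = 1"
    using W by (subst det_four_block_mat_upper_right_zero[of _ n _ m]) simp_all
  moreover have "Determinant.det ?R1 = Determinant.det (1\<^sub>m m + W * U)"
    using U W UW by (subst det_four_block_mat_lower_left_zero[of _ n _ m]) simp_all
  moreover have "Determinant.det ?R2 = Determinant.det (1\<^sub>m n + U * W)"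
    using U W UW by (subst det_four_block_mat_lower_left_zero[of _ n _ m]) simp_all
  ultimately show ?thesis by simp
qed
text \<open>
  The matrix determinant lemma: factor \<open>A + u v\<^sup>T = A (1 + (B u) v\<^sup>T)\<close> and exchange the two factors
  by Sylvester's identity, which leaves a determinant of size one.
\<close>

lemma det_rank_one_update:
  fixes A B :: "'a :: idom mat"
  assumes A: "A \<in> carrier_mat n n" and B: "B \<in> carrier_mat n n" and AB: "A * B = 1\<^sub>m n"
    and u: "u \<in> carrier_vec n" and v: "v \<in> carrier_vec n"
  shows "Determinant.det (A + Matrix.mat n n (\<lambda>(i, j). u $ i * v $ j))
       = Determinant.det A * (1 + v \<bullet> (B *\<^sub>v u))"
proof -
  let ?U = "Matrix.mat n 1 (\<lambda>(i, _). (B *\<^sub>v u) $ i)"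
  let ?W = "Matrix.mat 1 n (\<lambda>(_, j). v $ j)"
  have U: "?U \<in> carrier_mat n 1" and W: "?W \<in> carrier_mat 1 n" by auto
  have ABu: "A *\<^sub>v (B *\<^sub>v u) = u"
    using assoc_mult_mat_vec[OF A B u] AB u by simp
  have col_U: "Matrix.col ?U 0 = B *\<^sub>v u"
    using B u by (intro eq_vecI) auto
  have AU: "A * ?U = Matrix.mat n 1 (\<lambda>(i, _). u $ i)"
  proof (intro eq_matI)
    fix i j assume "i < dim_row (Matrix.mat n 1 (\<lambda>(i, _). u $ i))"
      "j < dim_col (Matrix.mat n 1 (\<lambda>(i, _). u $ i))"
    then have ij: "i < n" "j = 0" by auto
    have "(A * ?U) $$ (i, j) = (A *\<^sub>v (B *\<^sub>v u)) $ i"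
      using ij A col_U by simp
    then show "(A * ?U) $$ (i, j) = Matrix.mat n 1 (\<lambda>(i, _). u $ i) $$ (i, j)"
      using ij ABu by simp
  qed (use A in auto)
  have "A * ?U * ?W = Matrix.mat n n (\<lambda>(i, j). u $ i * v $ j)"
    unfolding AU by (intro eq_matI) (auto simp: scalar_prod_def)
  then have "A + Matrix.mat n n (\<lambda>(i, j). u $ i * v $ j) = A * (1\<^sub>m n + ?U * ?W)"
    using mult_add_distrib_mat[OF A one_carrier_mat mult_carrier_mat[OF U W]] assoc_mult_mat[OF A U W] A
    by simp
  then have "Determinant.det (A + Matrix.mat n n (\<lambda>(i, j). u $ i * v $ j))
      = Determinant.det A * Determinant.det (1\<^sub>m n + ?U * ?W)"
    using det_mult[OF A add_carrier_mat[OF mult_carrier_mat[OF U W], of "1\<^sub>m n"]] by simp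
  also have "Determinant.det (1\<^sub>m n + ?U * ?W) = Determinant.det (1\<^sub>m 1 + ?W * ?U)"
    by (rule det_one_plus_mult_commute[OF U W])
  also have "\<dots> = (1\<^sub>m 1 + ?W * ?U) $$ (0, 0)"
    by (rule det_single) auto
  also have "\<dots> = 1 + v \<bullet> (B *\<^sub>v u)"
  proof -
    have "Matrix.row ?W 0 = v" using v by (intro eq_vecI) auto
    then show ?thesis using col_U by simp
  qed
  finally show ?thesis .
qed

lemma scalar_prod_mult_mat_vec_eq_sum:
  fixes B :: "'a :: comm_semiring_0 mat"
  assumes "B \<in> carrier_mat n n" "u \<in> carrier_vec n" "v \<in> carrier_vec n"
  shows "u \<bullet> (B *\<^sub>v v) = (\<Sum>i<n. \<Sum>j<n. u $ i * v $ j * B $$ (i, j))"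
  using assms by (auto simp: scalar_prod_def atLeast0LessThan sum_distrib_left ac_simps intro!: sum.cong)

text \<open>
  Every matrix on the segment from the identity to \<open>A\<close> is positive definite, hence nonsingular. The
  determinant is continuous along the segment and equals \<open>1\<close> at its start, so it cannot change sign.
\<close>

lemma det_pos_of_pos_def:
  fixes A :: "real mat"
  assumes A: "A \<in> carrier_mat n n"
    and pos: "\<And>c. c \<in> carrier_vec n \<Longrightarrow> c \<noteq> 0\<^sub>v n \<Longrightarrow> c \<bullet> (A *\<^sub>v c) > 0"
  shows "Determinant.det A > 0"
proof (rule ccontr)
  assume neg: "\<not> Determinant.det A > 0"
  define H where "H t = t \<cdot>\<^sub>m A + (1 - t) \<cdot>\<^sub>m 1\<^sub>m n" for t :: real
  have H: "H t \<in> carrier_mat n n" for t using A by (auto simp: H_def)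
  have H_entry: "H t $$ (i, j) = t * A $$ (i, j) + (1 - t) * 1\<^sub>m n $$ (i, j)" if "i < n" "j < n" for t i j
    using that A by (auto simp: H_def)
  then have det_H: "Determinant.det (H t) = (\<Sum>p | p permutes {0..<n}.
     of_int (sign p) * (\<Prod>i = 0..<n. t * A $$ (i, p i) + (1 - t) * 1\<^sub>m n $$ (i, p i)))" for t
    unfolding det_def'[OF H] using H_entry by (intro sum.cong prod.cong refl arg_cong2[where f = "(*)"]) (auto dest: permutes_in_image)
  have "continuous_on {0..1} (\<lambda>t. Determinant.det (H t))"
    unfolding det_H by (intro continuous_intros)
  moreover have "H 0 = 1\<^sub>m n" "H 1 = A" using A by (auto simp: H_def)
  ultimately obtain t where t: "0 \<le> t" "t \<le> 1" "Determinant.det (H t) = 0"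
    using IVT2'[of "\<lambda>t. Determinant.det (H t)" 1 0 0] neg by auto
  then obtain c where c: "c \<in> carrier_vec n" "c \<noteq> 0\<^sub>v n" "H t *\<^sub>v c = 0\<^sub>v n"
    using det_0_iff_vec_prod_zero[OF H] by blast
  have "0 = c \<bullet> (H t *\<^sub>v c)" using c by simp
  also have "\<dots> = t * (c \<bullet> (A *\<^sub>v c)) + (1 - t) * (c \<bullet> (1\<^sub>m n *\<^sub>v c))"
    unfolding scalar_prod_mult_mat_vec_eq_sum[OF H c(1) c(1)] scalar_prod_mult_mat_vec_eq_sum[OF A c(1) c(1)]
      scalar_prod_mult_mat_vec_eq_sum[OF one_carrier_mat c(1) c(1)]
    by (simp add: H_entry sum_distrib_left sum.distrib[symmetric] algebra_simps del: index_one_mat)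
  finally have eq: "t * (c \<bullet> (A *\<^sub>v c)) + (1 - t) * (c \<bullet> c) = 0" using c by simp
  have cc: "c \<bullet> c > 0"
  proof -
    obtain i where "i < n" "c $ i \<noteq> 0"
      using c by (metis eq_vecI index_zero_vec carrier_vecD)
    then have "0 < (\<Sum>i<n. (c $ i)\<^sup>2)" by (intro sum_pos2[of _ i]) auto
    also have "\<dots> = c \<bullet> c"
      using c by (simp add: scalar_prod_def power2_eq_square atLeast0LessThan)
    finally show ?thesis .
  qed
  have "t * (c \<bullet> (A *\<^sub>v c)) \<ge> 0" "(1 - t) * (c \<bullet> c) \<ge> 0" "t \<noteq> 0 \<longrightarrow> t * (c \<bullet> (A *\<^sub>v c)) > 0"
    using t cc pos[OF c(1,2)] by auto
  then show False using eq cc by (cases "t = 0") auto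
qed

lemma mat_inverse_of_det_nonzero:
  fixes A :: "'a :: field mat"
  assumes A: "A \<in> carrier_mat n n" and "Determinant.det A \<noteq> 0"
  obtains B where "mat_inverse A = Some B" "B \<in> carrier_mat n n" "A * B = 1\<^sub>m n" "B * A = 1\<^sub>m n"
proof (cases "mat_inverse A")
  case None
  then show thesis using det_non_zero_imp_unit[OF assms] mat_inverse(1)[OF A] by metis
next
  case (Some B)
  then show thesis using mat_inverse(2)[OF A Some] by (intro that[of B]) simp_all
qed

section \<open>Zeros of polynomials and the number of monomials\<close>

lemma real_polynomial_function_monomial_eval: "real_polynomial_function (monomial_eval \<alpha>)"
  unfolding monomial_eval_def[abs_def]
  by (intro real_polynomial_function_prod real_polynomial_function_power real_polynomial_function.intros(1)
      bounded_linear_vec_nth) auto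

lemma real_polynomial_function_poly_eval: "real_polynomial_function (poly_eval p)"
  unfolding poly_eval_def[abs_def]
  by (intro real_polynomial_function_sum real_polynomial_function.intros(4) real_polynomial_function.intros(2)
      real_polynomial_function_monomial_eval finite_keys)

text \<open>
  On the line from a point of \<open>U\<close> to \<open>y\<close> the function is a univariate polynomial with infinitely many
  roots.
\<close>

lemma real_polynomial_function_zero_on_open:
  fixes p :: "'a :: real_normed_vector \<Rightarrow> real"
  assumes p: "real_polynomial_function p" and "open U" "U \<noteq> {}" and zero: "\<And>x. x \<in> U \<Longrightarrow> p x = 0"
  shows "p y = 0"
proof -
  obtain x0 where x0: "x0 \<in> U" using assms by blast
  define l where "l t = x0 + t *\<^sub>R (y - x0)" for t :: real
  have "polynomial_function l"
    unfolding l_def by (intro polynomial_function_add polynomial_function_const)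
      (simp add: polynomial_function_def o_def linear_simps real_polynomial_function.intros(4)
        real_polynomial_function.intros(2) real_polynomial_function.intros(1) bounded_linear_ident)
  then have "real_polynomial_function (p \<circ> l)"
    using p by (rule real_polynomial_function_compose)
  then obtain a n where an: "p \<circ> l = (\<lambda>t. \<Sum>i\<le>n. a i * t ^ i)"
    unfolding real_polynomial_function_iff_sum by blast
  have "continuous_on UNIV l" unfolding l_def by (intro continuous_intros)
  then have "open (l -` U)" using \<open>open U\<close> by (simp add: open_vimage)
  moreover have "0 \<in> l -` U" using x0 by (simp add: l_def)
  ultimately have "infinite (l -` U)"
    using finite_imp_not_open by blast
  moreover have "l -` U \<subseteq> {t. (\<Sum>i\<le>n. a i * t ^ i) = 0}"
    using zero fun_cong[OF an] by (auto simp flip: fun_cong[OF an])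
  ultimately have "infinite {t. (\<Sum>i\<le>n. a i * t ^ i) = 0}"
    using finite_subset by blast
  then have "\<forall>i\<le>n. a i = 0"
    using polyfun_finite_roots[of a n] by blast
  then have "(p \<circ> l) 1 = 0" unfolding an by simp
  then show ?thesis by (simp add: l_def)
qed

text \<open>
  A nonzero polynomial has no zeros on some nonempty open part of \<open>U\<close>, and there the other factor has
  to vanish.
\<close>

lemma real_polynomial_function_mult_zero_on_open:
  fixes p q :: "'a :: real_normed_vector \<Rightarrow> real"
  assumes p: "real_polynomial_function p" and q: "real_polynomial_function q" and "q z \<noteq> 0"
    and U: "open U" "U \<noteq> {}" and zero: "\<And>x. x \<in> U \<Longrightarrow> p x * q x = 0"
  shows "p y = 0"
proof -
  obtain x1 where x1: "x1 \<in> U" "q x1 \<noteq> 0"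
    using real_polynomial_function_zero_on_open[OF q U] \<open>q z \<noteq> 0\<close> by metis
  have "continuous_on U q"
    using q continuous_on_polymonial_function by (auto simp: real_polynomial_function_eq)
  then have "open (U \<inter> q -` (- {0}))"
    using U by (intro continuous_open_preimage) auto
  moreover have "x1 \<in> U \<inter> q -` (- {0})" using x1 by auto
  ultimately show ?thesis
    using real_polynomial_function_zero_on_open[OF p, of "U \<inter> q -` (- {0})"] zero by fastforce
qed

text \<open>
  Doubling the coordinate \<open>l\<close> of \<open>x\<close> multiplies the monomial of \<open>\<gamma>\<close> by a power of two with exponent
  \<open>\<gamma> l\<close>. Subtracting a multiple of the given relation from the scaled one eliminates the monomial
  \<open>e j\<close>, and by induction all remaining coefficients vanish. A monomial different from \<open>e j\<close> survives
  this elimination for at least one choice of \<open>l\<close>. Families rather than sets of multi-indices are used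
  so that the result applies both to supports of polynomials and to enumerated monomial vectors.
\<close>

lemma monomials_linear_independent:
  fixes e :: "'i \<Rightarrow> 'd::finite multi_index"
  assumes "finite I" and "inj_on e I" and "\<And>x. (\<Sum>i\<in>I. c i * monomial_eval (e i) x) = 0" and "i \<in> I"
  shows "c i = 0"
  using assms
proof (induction I arbitrary: c i rule: finite_induct)
  case empty
  then show ?case by simp
next
  case (insert j I)
  have scale: "monomial_eval \<gamma> (\<chi> k. if k = l then 2 * vec_nth x k else vec_nth x k)
      = 2 ^ Poly_Mapping.lookup \<gamma> l * monomial_eval \<gamma> x" for \<gamma> :: "'d multi_index" and l and x
  proof -
    have "monomial_eval \<gamma> (\<chi> k. if k = l then 2 * vec_nth x k else vec_nth x k)
        = (\<Prod>k\<in>UNIV. (if k = l then 2 ^ Poly_Mapping.lookup \<gamma> l else 1) * vec_nth x k ^ Poly_Mapping.lookup \<gamma> k)"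
      unfolding monomial_eval_def by (intro prod.cong) (auto simp: power_mult_distrib)
    also have "\<dots> = 2 ^ Poly_Mapping.lookup \<gamma> l * monomial_eval \<gamma> x"
      by (simp add: prod.distrib monomial_eval_def)
    finally show ?thesis .
  qed
  have I0: "c i = 0" if i: "i \<in> I" for i
  proof -
    have "e i \<noteq> e j" using i insert.hyps insert.prems(1) by (auto simp: inj_on_def)
    then obtain l where l: "Poly_Mapping.lookup (e i) l \<noteq> Poly_Mapping.lookup (e j) l"
      by (metis poly_mapping_eqI)
    let ?d = "\<lambda>i. 2 ^ Poly_Mapping.lookup (e i) l - 2 ^ Poly_Mapping.lookup (e j) l :: real"
    have "(\<Sum>i\<in>I. c i * ?d i * monomial_eval (e i) x) = 0" for x
    proof -
      have "(\<Sum>i\<in>insert j I. c i * ?d i * monomial_eval (e i) x)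
          = (\<Sum>i\<in>insert j I. c i * (2 ^ Poly_Mapping.lookup (e i) l * monomial_eval (e i) x))
            - 2 ^ Poly_Mapping.lookup (e j) l * (\<Sum>i\<in>insert j I. c i * monomial_eval (e i) x)"
        unfolding sum_distrib_left sum_subtractf[symmetric] by (intro sum.cong) (auto simp: algebra_simps)
      also have "\<dots> = 0"
        unfolding scale[symmetric] insert.prems(2) by simp
      finally show ?thesis using insert.hyps by simp
    qed
    from insert.IH[OF _ this i] insert.prems(1) have "c i * ?d i = 0" by simp
    then show ?thesis using l by simp
  qed
  have "c j * monomial_eval (e j) (\<chi> k. 1) = 0"
    using insert.prems(2)[of "\<chi> k. 1"] insert.hyps I0 by simp
  then have "c j = 0" by (simp add: monomial_eval_def)
  with I0 insert.prems(3) show ?case by blast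
qed

lemma poly_eval_nonzero:
  fixes p :: "'d::finite polynomial"
  assumes "p \<noteq> 0"
  obtains x where "poly_eval p x \<noteq> 0"
proof -
  have "\<exists>x. poly_eval p x \<noteq> 0"
  proof (rule ccontr)
    assume "\<nexists>x. poly_eval p x \<noteq> 0"
    then have "Poly_Mapping.lookup p \<alpha> = 0" if "\<alpha> \<in> Poly_Mapping.keys p" for \<alpha>
      using that monomials_linear_independent[of "Poly_Mapping.keys p" "\<lambda>\<alpha>. \<alpha>" "Poly_Mapping.lookup p"]
      by (auto simp: poly_eval_def)
    then have "p = 0" by (intro poly_mapping_eqI) (auto simp: in_keys_iff)
    then show False using assms by simp
  qed
  then show ?thesis using that by blast
qed

lemma poly_eval_one [simp]: "poly_eval 1 x = 1"
  by (simp add: poly_eval_def monomial_eval_def)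

text \<open>
  Stars and bars: recording the slack \<open>k - deg \<alpha>\<close> as an additional entry turns the multi-indices of
  degree at most \<open>k\<close> into the lists of length \<open>CARD('d) + 1\<close> with sum exactly \<open>k\<close>.
\<close>

lemma length_mi_list: "length (mi_list k :: 'd::finite multi_index list) = monomial_count CARD('d) k"
proof -
  obtain us :: "'d list" where us: "set us = UNIV" "distinct us"
    using finite_distinct_list[of "UNIV :: 'd set"] by auto
  have len_us: "length us = CARD('d)" using us distinct_card[of us] by simp
  have sum_us: "sum_list (map f us) = (\<Sum>i\<in>UNIV. f i)" for f :: "'d \<Rightarrow> nat"
    using sum_list_distinct_conv_sum_set[OF us(2), of f] us(1) by simp
  define enc where "enc \<alpha> = (k - mi_degree \<alpha>) # map (Poly_Mapping.lookup \<alpha>) us" for \<alpha> :: "'d multi_index"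
  let ?D = "{\<alpha> :: 'd multi_index. mi_degree \<alpha> \<le> k}"
  let ?L = "{l :: nat list. length l = Suc CARD('d) \<and> sum_list l = k}"
  have "bij_betw enc ?D ?L"
  proof (rule bij_betwI')
    fix \<alpha> \<beta> :: "'d multi_index" assume "\<alpha> \<in> ?D" "\<beta> \<in> ?D"
    have "enc \<alpha> = enc \<beta> \<Longrightarrow> \<alpha> = \<beta>"
      using us(1) by (intro poly_mapping_eqI) (auto simp: enc_def)
    then show "enc \<alpha> = enc \<beta> \<longleftrightarrow> \<alpha> = \<beta>" by blast
  next
    fix \<alpha> :: "'d multi_index" assume "\<alpha> \<in> ?D"
    then show "enc \<alpha> \<in> ?L"
      using sum_us[of "Poly_Mapping.lookup \<alpha>"] len_us by (simp add: enc_def mi_degree_def)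
  next
    fix l :: "nat list" assume l: "l \<in> ?L"
    then obtain a l' where l': "l = a # l'" "length l' = length us"
      using len_us by (cases l) auto
    define f where "f i = the (map_of (zip us l') i)" for i
    have lookup_f: "Poly_Mapping.lookup (Abs_poly_mapping f) = f" by (simp add: Abs_poly_mapping_inverse)
    have map_f: "map f us = l'"
      using l' us(2) by (intro nth_equalityI) (auto simp: f_def map_of_zip_nth)
    have "mi_degree (Abs_poly_mapping f) = sum_list l'"
      unfolding mi_degree_def lookup_f sum_us[symmetric] map_f ..
    then show "\<exists>\<alpha>\<in>?D. l = enc \<alpha>"
      using l l' map_f lookup_f by (intro bexI[of _ "Abs_poly_mapping f"]) (auto simp: enc_def)
  qed
  then have "card ?D = card ?L" by (rule bij_betw_same_card)
  also have "\<dots> = (k + CARD('d)) choose k" by (simp add: card_length_sum_list)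
  also have "\<dots> = monomial_count CARD('d) k"
    unfolding monomial_count_def by (subst binomial_symmetric) simp_all
  finally show ?thesis
    using distinct_card[OF distinct_mi_list[where 'd = 'd], of k] by (simp add: set_mi_list)
qed

section \<open>Moment matrices and Christoffel--Darboux kernels\<close>

lemma dim_monomial_vec [simp]:
  "dim_vec (monomial_vec k (x :: real ^ 'd::finite)) = length (mi_list k :: 'd multi_index list)"
  by (simp add: monomial_vec_def)

lemma monomial_vec_carrier [simp]:
  "monomial_vec k (x :: real ^ 'd::finite) \<in> carrier_vec (length (mi_list k :: 'd multi_index list))"
  by (rule carrier_vecI) simp

lemma moment_matrix_carrier [simp]:
  fixes g :: "'d::finite polynomial"
  shows "moment_matrix k g \<phi> \<in>
    carrier_mat (length (mi_list k :: 'd multi_index list)) (length (mi_list k :: 'd multi_index list))"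
  by (simp add: moment_matrix_def)

lemma index_monomial_vec:
  "i < length (mi_list k :: 'd::finite multi_index list) \<Longrightarrow>
    monomial_vec k (x :: real ^ 'd) $ i = monomial_eval (mi_list k ! i) x"
  by (simp add: monomial_vec_def vec_of_list_index)

lemma real_polynomial_function_monomial_vec:
  assumes "i < length (mi_list k :: 'd::finite multi_index list)"
  shows "real_polynomial_function (\<lambda>x :: real ^ 'd. monomial_vec k x $ i)"
  using assms by (simp add: index_monomial_vec real_polynomial_function_monomial_eval)

lemma monomial_vec_linear_independent:
  assumes c: "c \<in> carrier_vec (length (mi_list k :: 'd::finite multi_index list))"
    and zero: "\<And>x :: real ^ 'd. c \<bullet> monomial_vec k x = 0"
  shows "c = 0\<^sub>v (length (mi_list k :: 'd multi_index list))"
proof (rule eq_vecI)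
  let ?l = "mi_list k :: 'd multi_index list"
  fix i assume i: "i < dim_vec (0\<^sub>v (length ?l) :: real Matrix.vec)"
  have "(\<Sum>i<length ?l. c $ i * monomial_eval (?l ! i) x) = 0" for x :: "real ^ 'd"
    using zero[of x] by (simp add: scalar_prod_def atLeast0LessThan index_monomial_vec)
  then have "c $ i = 0"
    using i by (intro monomials_linear_independent[of "{..<length ?l}" "nth ?l" "vec_index c"])
      (auto simp: inj_on_nth distinct_mi_list)
  then show "c $ i = 0\<^sub>v (length ?l) $ i" using i by simp
qed (use c in simp)

lemma space_borel_prob_measures: "\<phi> \<in> borel_prob_measures S \<Longrightarrow> space \<phi> = S"
  by (auto simp: borel_prob_measures_def space_restrict_space dest: sets_eq_imp_space_eq)

lemma continuous_bounded_on_compact: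
  fixes h :: "'a :: topological_space \<Rightarrow> 'b :: real_normed_vector"
  assumes S: "compact S" and h: "continuous_on UNIV h"
  shows "\<exists>b. \<forall>x\<in>S. norm (h x) \<le> b"
proof -
  have "compact (h ` S)"
    by (rule compact_continuous_image[OF continuous_on_subset[OF h subset_UNIV] S])
  then have "bounded (h ` S)" by (rule compact_imp_bounded)
  then obtain b where "\<forall>y\<in>h ` S. norm y \<le> b" unfolding bounded_iff by (elim exE)
  then show ?thesis by blast
qed

lemma integrable_continuous_compact:
  fixes h :: "'a :: topological_space \<Rightarrow> real"
  assumes S: "compact S" and \<phi>: "\<phi> \<in> borel_prob_measures S" and h: "continuous_on UNIV h"
  shows "integrable \<phi> h"
proof -
  interpret prob_space \<phi> using \<phi> by (simp add: borel_prob_measures_def)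
  obtain b where b: "\<forall>x\<in>S. norm (h x) \<le> b"
    using continuous_bounded_on_compact[OF S h] by blast
  have "h \<in> borel_measurable (restrict_space borel S)"
    using h by (intro measurable_restrict_space1 borel_measurable_continuous_onI)
  then have "h \<in> borel_measurable \<phi>"
    using \<phi> by (simp add: borel_prob_measures_def cong: measurable_cong_sets)
  then show ?thesis
    using b space_borel_prob_measures[OF \<phi>] by (intro integrable_const_bound[of _ b]) auto
qed

lemma integrable_polynomial:
  fixes h :: "'a :: real_normed_vector \<Rightarrow> real"
  assumes "compact S" "\<phi> \<in> borel_prob_measures S" "real_polynomial_function h"
  shows "integrable \<phi> h"
  using assms by (intro integrable_continuous_compact)
    (auto simp: real_polynomial_function_eq continuous_on_polymonial_function)

text \<open>
  Linear functionals of a moment matrix are integrals of polynomials. Quadratic forms and traces,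
  the two uses below, are special cases.
\<close>

lemma sum_moment_matrix:
  fixes g :: "'d::finite polynomial" and k :: nat
  defines "N \<equiv> length (mi_list k :: 'd multi_index list)"
  assumes S: "compact S" "\<phi> \<in> borel_prob_measures S"
  shows "(\<Sum>i<N. \<Sum>j<N. b i j * moment_matrix k g \<phi> $$ (i, j))
       = (\<integral>x. (\<Sum>i<N. \<Sum>j<N. b i j * (monomial_vec k x $ i * monomial_vec k x $ j)) * poly_eval g x \<partial>\<phi>)"
proof -
  let ?m = "\<lambda>i j x. monomial_vec k x $ i * monomial_vec k x $ j * poly_eval g x"
  have int: "integrable \<phi> (?m i j)" if "i < N" "j < N" for i j
    using that unfolding N_def
    by (intro integrable_polynomial[OF S] real_polynomial_function.intros(4)
        real_polynomial_function_poly_eval real_polynomial_function_monomial_vec)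
  have "(\<Sum>i<N. \<Sum>j<N. b i j * moment_matrix k g \<phi> $$ (i, j))
      = (\<Sum>i<N. \<Sum>j<N. \<integral>x. b i j * ?m i j x \<partial>\<phi>)"
    by (simp add: moment_matrix_def N_def)
  also have "\<dots> = (\<Sum>i<N. \<integral>x. (\<Sum>j<N. b i j * ?m i j x) \<partial>\<phi>)"
    using int by (intro sum.cong refl Bochner_Integration.integral_sum[symmetric] integrable_mult_right) auto
  also have "\<dots> = (\<integral>x. (\<Sum>i<N. \<Sum>j<N. b i j * ?m i j x) \<partial>\<phi>)"
    using int by (intro Bochner_Integration.integral_sum[symmetric] Bochner_Integration.integrable_sum
        integrable_mult_right) auto
  also have "\<dots> = (\<integral>x. (\<Sum>i<N. \<Sum>j<N. b i j * (monomial_vec k x $ i * monomial_vec k x $ j)) * poly_eval g x \<partial>\<phi>)"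
    by (intro Bochner_Integration.integral_cong) (auto simp: sum_distrib_right mult.assoc)
  finally show ?thesis .
qed

lemma moment_matrix_quadratic_form:
  fixes g :: "'d::finite polynomial"
  assumes S: "compact S" "\<phi> \<in> borel_prob_measures S"
    and c: "c \<in> carrier_vec (length (mi_list k :: 'd multi_index list))"
  shows "c \<bullet> (moment_matrix k g \<phi> *\<^sub>v c) = (\<integral>x. (c \<bullet> monomial_vec k x)\<^sup>2 * poly_eval g x \<partial>\<phi>)"
proof -
  have "(c \<bullet> monomial_vec k x)\<^sup>2
      = (\<Sum>i<length (mi_list k :: 'd multi_index list). \<Sum>j<length (mi_list k :: 'd multi_index list).
          c $ i * c $ j * (monomial_vec k x $ i * monomial_vec k x $ j))" for x :: "real ^ 'd"
    by (simp add: scalar_prod_def atLeast0LessThan power2_eq_square sum_product ac_simps)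
  then show ?thesis
    unfolding scalar_prod_mult_mat_vec_eq_sum[OF moment_matrix_carrier c c]
      sum_moment_matrix[OF S] by simp
qed

text \<open>
  Integration turns \<open>v\<^sup>T M\<^sup>-\<^sup>1 v\<close> into the trace of \<open>M\<^sup>-\<^sup>1 M\<close>, the integral of \<open>g v v\<^sup>T\<close> being \<open>M\<close>.
\<close>

lemma integral_cd_kernel:
  fixes g :: "'d::finite polynomial"
  assumes S: "compact S" "\<phi> \<in> borel_prob_measures S"
    and det: "Determinant.det (moment_matrix k g \<phi>) \<noteq> 0"
  shows "(\<integral>x. poly_eval g x * cd_kernel k g \<phi> x x \<partial>\<phi>) = real (length (mi_list k :: 'd multi_index list))"
proof -
  let ?N = "length (mi_list k :: 'd multi_index list)"
  let ?M = "moment_matrix k g \<phi>"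
  obtain B where B: "mat_inverse ?M = Some B" "B \<in> carrier_mat ?N ?N" "?M * B = 1\<^sub>m ?N" "B * ?M = 1\<^sub>m ?N"
    using mat_inverse_of_det_nonzero[OF moment_matrix_carrier det] .
  have sym: "?M $$ (i, j) = ?M $$ (j, i)" if "i < ?N" "j < ?N" for i j
    using that by (simp add: moment_matrix_def mult.commute)
  have "(\<integral>x. poly_eval g x * cd_kernel k g \<phi> x x \<partial>\<phi>)
      = (\<integral>x. (\<Sum>i<?N. \<Sum>j<?N. B $$ (i, j) * (monomial_vec k x $ i * monomial_vec k x $ j)) * poly_eval g x \<partial>\<phi>)"
    unfolding cd_kernel_def B(1) option.sel
      scalar_prod_mult_mat_vec_eq_sum[OF B(2) monomial_vec_carrier monomial_vec_carrier]
    by (simp add: mult.commute)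
  also have "\<dots> = (\<Sum>i<?N. \<Sum>j<?N. B $$ (i, j) * ?M $$ (i, j))"
    by (rule sum_moment_matrix[OF S, symmetric])
  also have "\<dots> = (\<Sum>i<?N. (B * ?M) $$ (i, i))"
  proof (rule sum.cong)
    fix i assume "i \<in> {..<?N}"
    then have i: "i < ?N" by simp
    then have "(B * ?M) $$ (i, i) = (\<Sum>j<?N. B $$ (i, j) * ?M $$ (j, i))"
      using carrier_matD[OF B(2)] carrier_matD[OF moment_matrix_carrier[of k g \<phi>]]
      by (simp add: scalar_prod_def atLeast0LessThan)
    \<comment> \<open>symmetry of the moment matrix turns the entrywise product into a matrix product\<close>
    then show "(\<Sum>j<?N. B $$ (i, j) * ?M $$ (i, j)) = (B * ?M) $$ (i, i)"
      using sym i by simp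
  qed simp
  also have "\<dots> = real ?N" unfolding B(4) by simp
  finally show ?thesis .
qed

lemma real_polynomial_function_cd_kernel:
  fixes g :: "'d::finite polynomial"
  assumes det: "Determinant.det (moment_matrix k g \<phi>) \<noteq> 0"
  shows "real_polynomial_function (\<lambda>x. cd_kernel k g \<phi> x x)"
proof -
  let ?N = "length (mi_list k :: 'd multi_index list)"
  obtain B where B: "mat_inverse (moment_matrix k g \<phi>) = Some B" "B \<in> carrier_mat ?N ?N"
      "moment_matrix k g \<phi> * B = 1\<^sub>m ?N" "B * moment_matrix k g \<phi> = 1\<^sub>m ?N"
    using mat_inverse_of_det_nonzero[OF moment_matrix_carrier det] .
  show ?thesis
    unfolding cd_kernel_def B(1) option.sel
      scalar_prod_mult_mat_vec_eq_sum[OF B(2) monomial_vec_carrier monomial_vec_carrier]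
    by (intro real_polynomial_function_sum real_polynomial_function.intros(2,4)
        real_polynomial_function_monomial_vec) auto
qed

text \<open>
  With \<open>w = M\<^sup>-\<^sup>1 v\<close> the kernel is \<open>w\<^sup>T M w\<close>, the integral of the nonnegative function \<open>(w\<^sup>T v)\<^sup>2 g\<close>.
\<close>

lemma cd_kernel_diag_nonneg:
  fixes g :: "'d::finite polynomial"
  assumes S: "compact S" "\<phi> \<in> borel_prob_measures S"
    and det: "Determinant.det (moment_matrix k g \<phi>) \<noteq> 0"
    and g: "\<And>x. x \<in> S \<Longrightarrow> poly_eval g x \<ge> 0"
  shows "cd_kernel k g \<phi> x x \<ge> 0"
proof -
  let ?N = "length (mi_list k :: 'd multi_index list)"
  let ?M = "moment_matrix k g \<phi>" and ?v = "monomial_vec k x"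
  obtain B where B: "mat_inverse ?M = Some B" "B \<in> carrier_mat ?N ?N" "?M * B = 1\<^sub>m ?N" "B * ?M = 1\<^sub>m ?N"
    using mat_inverse_of_det_nonzero[OF moment_matrix_carrier det] .
  define w where "w = B *\<^sub>v ?v"
  have w: "w \<in> carrier_vec ?N" using B(2) by (simp add: w_def)
  have "?M *\<^sub>v w = ?v"
    unfolding w_def
    using assoc_mult_mat_vec[OF moment_matrix_carrier B(2) monomial_vec_carrier, of g \<phi> x] B(3) by simp
  then have "cd_kernel k g \<phi> x x = w \<bullet> (?M *\<^sub>v w)"
    unfolding cd_kernel_def B(1) option.sel w_def[symmetric]
    using w by (simp add: comm_scalar_prod[OF monomial_vec_carrier])
  also have "\<dots> \<ge> 0"
    unfolding moment_matrix_quadratic_form[OF S w]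
    using g space_borel_prob_measures[OF S(2)] by (intro Bochner_Integration.integral_nonneg_AE AE_I2) auto
  finally show ?thesis .
qed

section \<open>The uniform distribution has nonsingular moment matrices\<close>

text \<open>
  The points of the interior at which \<open>h\<close> is nonzero form an open null set, so there are none.
\<close>

lemma zero_on_interior_of_AE:
  fixes h :: "'a::euclidean_space \<Rightarrow> real"
  assumes h: "continuous_on UNIV h" and ae: "AE x in lborel. x \<in> S \<longrightarrow> h x = 0"
    and x: "x \<in> interior S"
  shows "h x = 0"
proof -
  let ?U = "interior S \<inter> h -` (- {0})"
  have "open ?U"
    using h by (intro continuous_open_preimage) (auto intro: continuous_on_subset)
  moreover have "?U \<in> null_sets lborel"
  proof -
    have "?U \<in> sets lborel" using \<open>open ?U\<close> by simp
    moreover have "AE x in lborel. x \<notin> ?U"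
      using ae by eventually_elim (use interior_subset in auto)
    ultimately show ?thesis by (simp add: AE_iff_null_sets)
  qed
  then have "negligible ?U"
    by (simp add: negligible_iff_null_sets null_sets_completionI)
  ultimately have "?U = {}" using open_not_negligible by blast
  then show ?thesis using x by auto
qed

lemma
  fixes S :: "(real ^ 'd::finite) set"
  assumes S: "compact S" "interior S \<noteq> {}"
  shows uniform_measure_in_borel_prob_measures:
      "uniform_measure (restrict_space lborel S) S \<in> borel_prob_measures S"
    and emeasure_restrict_lborel_pos: "emeasure (restrict_space lborel S) S \<noteq> 0"
    and emeasure_restrict_lborel_finite: "emeasure (restrict_space lborel S) S < \<infinity>"
proof -
  have S_sets: "S \<in> sets lborel" using S(1) by (simp add: borel_compact)
  have e: "emeasure (restrict_space lborel S) S = emeasure lborel S"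
    using S_sets by (subst emeasure_restrict_space) auto
  have "emeasure lborel S \<noteq> 0"
  proof
    assume "emeasure lborel S = 0"
    then have "negligible S"
      using S_sets by (simp add: negligible_iff_null_sets null_sets_completionI null_setsI)
    then show False
      using S(2) open_not_negligible[OF open_interior] negligible_subset interior_subset by blast
  qed
  moreover have "emeasure lborel S < \<infinity>"
    using S(1) by (intro emeasure_bounded_finite compact_imp_bounded)
  ultimately show e': "emeasure (restrict_space lborel S) S \<noteq> 0"
    "emeasure (restrict_space lborel S) S < \<infinity>"
    using e by auto
  show "uniform_measure (restrict_space lborel S) S \<in> borel_prob_measures S"
    using e' by (auto simp: borel_prob_measures_def intro!: prob_space_uniform_measure sets_restrict_space_cong)
qed

text \<open>
  If the quadratic form vanishes at \<open>c\<close>, then so does the polynomial \<open>(c\<^sup>T v)\<^sup>2 g\<close> on the interior of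
  \<open>S\<close>. As \<open>g\<close> is not the zero polynomial, \<open>c\<^sup>T v\<close> vanishes identically, and \<open>c = 0\<close> since the monomials
  are linearly independent.
\<close>

lemma moment_matrix_uniform_det_pos:
  fixes g :: "'d::finite polynomial"
  assumes S: "compact S" "interior S \<noteq> {}" and g: "g \<noteq> 0" "\<And>x. x \<in> S \<Longrightarrow> poly_eval g x \<ge> 0"
  shows "Determinant.det (moment_matrix k g (uniform_measure (restrict_space lborel S) S)) > 0"
proof (rule det_pos_of_pos_def[OF moment_matrix_carrier])
  let ?N = "length (mi_list k :: 'd multi_index list)"
  let ?u = "uniform_measure (restrict_space lborel S) S"
  fix c :: "real Matrix.vec" assume c: "c \<in> carrier_vec ?N" "c \<noteq> 0\<^sub>v ?N"
  let ?h = "\<lambda>x. (c \<bullet> monomial_vec k x)\<^sup>2 * poly_eval g x"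
  note u = uniform_measure_in_borel_prob_measures[OF S]
  note emeasure_uniform = emeasure_restrict_lborel_pos[OF S] emeasure_restrict_lborel_finite[OF S]
  have S_sets: "S \<in> sets lborel" using S(1) by (simp add: borel_compact)
  have poly_c: "real_polynomial_function (\<lambda>x :: real ^ 'd. c \<bullet> monomial_vec k x)"
    unfolding scalar_prod_def dim_monomial_vec
    by (intro real_polynomial_function_sum real_polynomial_function.intros(2,4)
        real_polynomial_function_monomial_vec) auto
  have poly_h: "real_polynomial_function ?h"
    by (intro real_polynomial_function.intros(4) real_polynomial_function_power poly_c
        real_polynomial_function_poly_eval)
  have nonneg: "AE x in ?u. 0 \<le> ?h x"
    using g(2) space_borel_prob_measures[OF u] by (intro AE_I2) auto
  have "(\<integral>x. ?h x \<partial>?u) \<noteq> 0"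
  proof
    assume "(\<integral>x. ?h x \<partial>?u) = 0"
    then have "AE x in ?u. ?h x = 0"
      using integral_nonneg_eq_0_iff_AE[OF integrable_polynomial[OF S(1) u poly_h] nonneg] by simp
    then have "AE x in restrict_space lborel S. x \<in> S \<longrightarrow> ?h x = 0"
      using emeasure_uniform by (subst (asm) AE_uniform_measure) auto
    then have ae: "AE x in lborel. x \<in> S \<longrightarrow> ?h x = 0"
      using S_sets by (subst (asm) AE_restrict_space_iff) auto
    have zero: "(c \<bullet> monomial_vec k x)\<^sup>2 * poly_eval g x = 0" if "x \<in> interior S" for x
      using that poly_h
      by (intro zero_on_interior_of_AE[OF _ ae])
        (auto simp: real_polynomial_function_eq continuous_on_polymonial_function)
    obtain z where "poly_eval g z \<noteq> 0" using poly_eval_nonzero[OF g(1)] .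
    then have "(c \<bullet> monomial_vec k x)\<^sup>2 = 0" for x :: "real ^ 'd"
      by (rule real_polynomial_function_mult_zero_on_open[OF real_polynomial_function_power[OF poly_c]
            real_polynomial_function_poly_eval _ open_interior S(2) zero])
    then have "c = 0\<^sub>v ?N"
      using monomial_vec_linear_independent[OF c(1)] by simp
    with c(2) show False by blast
  qed
  moreover have "(\<integral>x. ?h x \<partial>?u) \<ge> 0"
    using nonneg by (rule Bochner_Integration.integral_nonneg_AE)
  ultimately show "c \<bullet> (moment_matrix k g ?u *\<^sub>v c) > 0"
    unfolding moment_matrix_quadratic_form[OF S(1) u c(1)] by simp
qed

section \<open>Moving mass to a point\<close>

text \<open>
  The mixture is obtained by first tossing a coin and then drawing from \<open>\<mu>\<close> or returning \<open>x\<close>.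
\<close>

lemma borel_prob_measures_mix_point:
  fixes S :: "'a :: t2_space set"
  assumes S: "compact S" and \<mu>: "\<mu> \<in> borel_prob_measures S" and x: "x \<in> S" and t: "0 \<le> t" "t \<le> 1"
  obtains \<phi> where "\<phi> \<in> borel_prob_measures S"
    and "\<And>h :: 'a \<Rightarrow> real. continuous_on UNIV h \<Longrightarrow> (\<integral>y. h y \<partial>\<phi>) = (1 - t) * (\<integral>y. h y \<partial>\<mu>) + t * h x"
proof -
  let ?K = "restrict_space borel S"
  let ?N = "\<lambda>b. if b then return ?K x else \<mu>"
  let ?B = "measure_pmf (bernoulli_pmf t)"
  have \<mu>_prob: "prob_space \<mu>" and sets_\<mu>: "sets \<mu> = sets ?K"
    using \<mu> by (auto simp: borel_prob_measures_def)
  have xK: "x \<in> space ?K" using x by (simp add: space_restrict_space)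
  have N_prob: "prob_space (?N b)" and N_sets: "sets (?N b) = sets ?K" for b
    using \<mu>_prob sets_\<mu> prob_space_return[OF xK] by auto
  have N: "?N \<in> measurable ?B (subprob_algebra ?K)"
    using N_prob N_sets by (auto simp: space_subprob_algebra prob_space_imp_subprob_space)
  have "prob_space (?B \<bind> ?N)"
    using N_prob by (intro measure_pmf.prob_space_bind[OF _ N]) auto
  moreover have "sets (?B \<bind> ?N) = sets ?K"
    using N_sets by (intro sets_bind) auto
  ultimately have "?B \<bind> ?N \<in> borel_prob_measures S"
    by (simp add: borel_prob_measures_def)
  moreover have "(\<integral>y. h y \<partial>(?B \<bind> ?N)) = (1 - t) * (\<integral>y. h y \<partial>\<mu>) + t * h x"
    if h: "continuous_on UNIV h" for h :: "'a \<Rightarrow> real"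
  proof -
    have h_meas: "h \<in> borel_measurable ?K"
      using h by (intro measurable_restrict_space1 borel_measurable_continuous_onI)
    obtain b where b: "\<forall>x\<in>S. norm (h x) \<le> b"
      using continuous_bounded_on_compact[OF S h] by blast
    have "(\<integral>y. h y \<partial>(?B \<bind> ?N)) = (\<integral>b. (\<integral>y. h y \<partial>(?N b)) \<partial>?B)"
    proof (rule integral_bind[OF h_meas _ N])
      show "\<bar>h y\<bar> \<le> b" if "y \<in> space ?K" for y
        using bspec[OF b, of y] that by (simp add: space_restrict_space)
      show "finite_measure ?B" by (rule measure_pmf.finite_measure_axioms)
      show "AE b in ?B. emeasure (?N b) (space (?N b)) \<le> ennreal 1"
        using prob_space.emeasure_space_1[OF N_prob] by simp
    qed
    also have "\<dots> = (1 - t) * (\<integral>y. h y \<partial>\<mu>) + t * h x"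
      using t integral_return[OF xK h_meas] by (simp add: integral_bernoulli_pmf mult.commute)
    finally show ?thesis .
  qed
  ultimately show ?thesis using that by blast
qed

text \<open>
  The weight \<open>\<tau> / (1 + \<tau>)\<close> of the point mass makes the moment matrix of \<open>\<phi>\<close> equal to
  \<open>1 / (1 + \<tau>)\<close> times a rank-one update of that of \<open>\<mu>\<close>.
\<close>

lemma det_moment_matrix_mix_point:
  fixes g :: "'d::finite polynomial"
  assumes S: "compact S" "\<mu> \<in> borel_prob_measures S" "x \<in> S" and \<tau>: "\<tau> > 0"
    and det: "Determinant.det (moment_matrix k g \<mu>) \<noteq> 0"
    and mix: "\<And>h. continuous_on UNIV h \<Longrightarrow>
      (\<integral>y. h y \<partial>\<phi>) = (1 - \<tau> / (1 + \<tau>)) * (\<integral>y. h y \<partial>\<mu>) + \<tau> / (1 + \<tau>) * h x"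
  shows "Determinant.det (moment_matrix k g \<phi>)
    = (1 / (1 + \<tau>)) ^ length (mi_list k :: 'd multi_index list) *
      (Determinant.det (moment_matrix k g \<mu>) * (1 + \<tau> * (poly_eval g x * cd_kernel k g \<mu> x x)))"
proof -
  let ?N = "length (mi_list k :: 'd multi_index list)"
  let ?M = "moment_matrix k g \<mu>" and ?v = "monomial_vec k x" and ?c = "\<tau> * poly_eval g x"
  let ?R = "Matrix.mat ?N ?N (\<lambda>(i, j). (?c \<cdot>\<^sub>v ?v) $ i * ?v $ j)"
  define q where "q = 1 / (1 + \<tau>)"
  have w: "\<tau> / (1 + \<tau>) = q * \<tau>" "1 - q * \<tau> = q"
    using \<tau> by (auto simp: q_def field_simps)
  obtain B where B: "mat_inverse ?M = Some B" "B \<in> carrier_mat ?N ?N" "?M * B = 1\<^sub>m ?N" "B * ?M = 1\<^sub>m ?N"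
    using mat_inverse_of_det_nonzero[OF moment_matrix_carrier det] .
  have entry: "moment_matrix k g \<phi> $$ (i, j) = q * (?M $$ (i, j) + ?c * ?v $ i * ?v $ j)"
    if "i < ?N" "j < ?N" for i j
  proof -
    have "real_polynomial_function (\<lambda>y :: real ^ 'd. monomial_vec k y $ i * monomial_vec k y $ j * poly_eval g y)"
      using that by (intro real_polynomial_function.intros(4)
        real_polynomial_function_poly_eval real_polynomial_function_monomial_vec)
    then have "continuous_on UNIV (\<lambda>y :: real ^ 'd. monomial_vec k y $ i * monomial_vec k y $ j * poly_eval g y)"
      by (simp add: real_polynomial_function_eq continuous_on_polymonial_function)
    from mix[OF this, unfolded w] show ?thesis
      using that by (simp add: moment_matrix_def algebra_simps)
  qed
  have "moment_matrix k g \<phi> = q \<cdot>\<^sub>m (?M + ?R)"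
  proof (rule eq_matI)
    fix i j assume "i < dim_row (q \<cdot>\<^sub>m (?M + ?R))" "j < dim_col (q \<cdot>\<^sub>m (?M + ?R))"
    then have ij: "i < ?N" "j < ?N" by auto
    then show "moment_matrix k g \<phi> $$ (i, j) = (q \<cdot>\<^sub>m (?M + ?R)) $$ (i, j)"
      unfolding entry[OF ij] by simp
  qed (simp_all add: moment_matrix_def)
  then have "Determinant.det (moment_matrix k g \<phi>) = q ^ ?N * Determinant.det (?M + ?R)"
    by (simp add: det_smult)
  also have "Determinant.det (?M + ?R) = Determinant.det ?M * (1 + ?v \<bullet> (B *\<^sub>v (?c \<cdot>\<^sub>v ?v)))"
    by (rule det_rank_one_update[OF moment_matrix_carrier B(2,3)]) auto
  also have "?v \<bullet> (B *\<^sub>v (?c \<cdot>\<^sub>v ?v)) = \<tau> * (poly_eval g x * cd_kernel k g \<mu> x x)"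
    unfolding cd_kernel_def B(1) option.sel mult_mat_vec[OF B(2) monomial_vec_carrier]
    using B(2) by (subst scalar_prod_smult_right) auto
  finally show ?thesis unfolding q_def .
qed

text \<open>
  The right derivatives at \<open>\<tau> = 0\<close> of the two sides, which agree there, are \<open>\<Sum>\<^sub>i a\<^sub>i\<close> and \<open>N\<close>.
\<close>

lemma sum_le_of_sum_ln_le:
  fixes a :: "'i \<Rightarrow> real"
  assumes "\<And>\<tau>. \<tau> > 0 \<Longrightarrow> (\<Sum>i\<in>I. ln (1 + \<tau> * a i)) \<le> N * ln (1 + \<tau>)"
  shows "(\<Sum>i\<in>I. a i) \<le> N"
proof (rule ccontr)
  assume neg: "\<not> (\<Sum>i\<in>I. a i) \<le> N"
  let ?f = "\<lambda>\<tau>. N * ln (1 + \<tau>) - (\<Sum>i\<in>I. ln (1 + \<tau> * a i))"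
  have "DERIV ?f 0 :> N - (\<Sum>i\<in>I. a i)"
    by (auto intro!: derivative_eq_intros)
  then obtain d where d: "d > 0" "\<And>h. h > 0 \<Longrightarrow> h < d \<Longrightarrow> ?f 0 > ?f (0 + h)"
    using DERIV_neg_dec_right[of ?f "N - (\<Sum>i\<in>I. a i)" 0] neg by auto
  show False
    using d(2)[of "d / 2"] d(1) assms[of "d / 2"] by simp
qed

lemma log_det_objective_eq_ln:
  assumes "\<And>j. j \<le> m \<Longrightarrow> Determinant.det (moment_matrix (n - half_degree (g j)) (g j) \<phi>) > 0"
  shows "log_det_objective m g n \<phi>
    = ereal (\<Sum>j\<in>{0..m}. ln (Determinant.det (moment_matrix (n - half_degree (g j)) (g j) \<phi>)))"
  unfolding log_det_objective_def sum_ereal[symmetric]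
  using assms by (intro sum.cong) (auto simp: log_det_def)

text \<open>
  An extended real sum can only be bounded below by a real number if none of its terms is
  \<open>-\<infinity>\<close>; for this it matters that no log-determinant is \<open>\<infinity>\<close>, which would absorb \<open>-\<infinity>\<close>.
\<close>

lemma det_pos_of_log_det_objective:
  assumes obj: "ereal c \<le> log_det_objective m g n \<phi>" and j: "j \<le> m"
  shows "Determinant.det (moment_matrix (n - half_degree (g j)) (g j) \<phi>) > 0"
proof (rule ccontr)
  let ?l = "\<lambda>j. log_det (moment_matrix (n - half_degree (g j)) (g j) \<phi>)"
  assume "\<not> Determinant.det (moment_matrix (n - half_degree (g j)) (g j) \<phi>) > 0"
  then have "\<bar>?l j\<bar> = \<infinity>" by (simp add: log_det_def)
  then have "finite {0..m} \<and> (\<exists>i\<in>{0..m}. \<bar>?l i\<bar> = \<infinity>)"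
    using j by (intro conjI bexI[of _ j]) simp_all
  then have "\<bar>sum ?l {0..m}\<bar> = \<infinity>"
    by (simp only: sum_Inf)
  then have "sum ?l {0..m} = \<infinity>"
    using obj by (auto simp: log_det_objective_def)
  then obtain i where "?l i = \<infinity>"
    by (auto simp: sum_Pinfty)
  then show False by (simp add: log_det_def split: if_splits)
qed

section \<open>Optimality conditions\<close>

theorem theorem2:
  fixes g :: "nat \<Rightarrow> 'd::finite polynomial"
    and m n :: nat
    and M :: real
    and S :: "(real ^ 'd) set"
    and r :: "nat \<Rightarrow> nat"
    and s :: "nat \<Rightarrow> nat"
    and \<mu> :: "(real ^ 'd) measure"
  assumes "m \<ge> 1"
    and "\<And>j. j \<in> {1..m} \<Longrightarrow> g j \<noteq> 0"
    and "g 0 = 1"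
    and "S = semialg_set m g"
    and "compact S"
    and "interior S \<noteq> {}"
    and "M > 0"
    and "\<And>x. poly_eval (g 1) x = M - (norm x)\<^sup>2"
    and "r = (\<lambda>j. half_degree (g j))"
    and "s = monomial_count CARD('d)"
    and "n \<ge> Max (r ` {0..m})"
    and "optimal_solution m g n \<mu>"
  shows "(\<forall>x\<in>S. (\<Sum>j\<in>{0..m}. real (s (n - r j)))
              - (\<Sum>j\<in>{0..m}. poly_eval (g j) x * cd_kernel (n - r j) (g j) \<mu> x x) \<ge> 0)
       \<and> (AE x in \<mu>. (\<Sum>j\<in>{0..m}. real (s (n - r j)))
              - (\<Sum>j\<in>{0..m}. poly_eval (g j) x * cd_kernel (n - r j) (g j) \<mu> x x) = 0)
       \<and> (\<forall>f :: real ^ 'd \<Rightarrow> real.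
            f \<in> borel_measurable (restrict_space borel S) \<longrightarrow>
            (\<forall>x\<in>S. f x > 0) \<longrightarrow>
            \<mu> = density (restrict_space lborel S) (\<lambda>x. ennreal (f x)) \<longrightarrow>
            (\<forall>x. (\<Sum>j\<in>{0..m}. real (s (n - r j)))
              = (\<Sum>j\<in>{0..m}. poly_eval (g j) x * cd_kernel (n - r j) (g j) \<mu> x x)))"
proof -
  let ?d = "\<lambda>\<phi> j. Determinant.det (moment_matrix (n - r j) (g j) \<phi>)"
  let ?K = "\<lambda>j x. cd_kernel (n - r j) (g j) \<mu> x x"
  let ?p = "\<lambda>x. (\<Sum>j\<in>{0..m}. real (s (n - r j))) - (\<Sum>j\<in>{0..m}. poly_eval (g j) x * ?K j x)"
  let ?u = "uniform_measure (restrict_space lborel S) S"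
  note r_def = \<open>r = (\<lambda>j. half_degree (g j))\<close>
  note S_def = \<open>S = semialg_set m g\<close>
  have len: "length (mi_list k :: 'd multi_index list) = s k" for k
    unfolding \<open>s = monomial_count CARD('d)\<close> by (rule length_mi_list)
  have g_nz: "g j \<noteq> 0" if "j \<le> m" for j
    using that \<open>g 0 = 1\<close> assms(2)[of j] by (cases "j = 0") auto
  have g_nonneg: "poly_eval (g j) x \<ge> 0" if "j \<le> m" "x \<in> S" for j x
    using that \<open>g 0 = 1\<close> unfolding S_def semialg_set_def by (cases "j = 0") auto
  have \<mu>: "\<mu> \<in> borel_prob_measures S"
    and opt: "\<And>\<phi>. \<phi> \<in> borel_prob_measures S \<Longrightarrow> log_det_objective m g n \<phi> \<le> log_det_objective m g n \<mu>"
    using \<open>optimal_solution m g n \<mu>\<close> unfolding optimal_solution_def S_def by auto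
  note obj_eq = log_det_objective_eq_ln[of m n g, folded fun_cong[OF r_def]]
  note S\<mu> = \<open>compact S\<close> \<mu>

  \<comment> \<open>comparison with the uniform distribution: the optimal value is finite\<close>
  have "?d ?u j > 0" if "j \<le> m" for j
    using that g_nz g_nonneg by (intro moment_matrix_uniform_det_pos[OF \<open>compact S\<close> \<open>interior S \<noteq> {}\<close>])
  then have "ereal (\<Sum>j\<in>{0..m}. ln (?d ?u j)) \<le> log_det_objective m g n \<mu>"
    using opt[OF uniform_measure_in_borel_prob_measures[OF \<open>compact S\<close> \<open>interior S \<noteq> {}\<close>]]
    by (simp add: obj_eq)
  then have d_pos: "?d \<mu> j > 0" if "j \<le> m" for j
    using det_pos_of_log_det_objective[OF _ that, of _ g n \<mu>] that by (simp add: r_def)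
  then have d_nz: "?d \<mu> j \<noteq> 0" if "j \<le> m" for j
    using that by (metis less_irrefl)
  have a_nonneg: "poly_eval (g j) x * ?K j x \<ge> 0" if "j \<le> m" "x \<in> S" for j x
    using that g_nonneg by (intro mult_nonneg_nonneg cd_kernel_diag_nonneg[OF S\<mu> d_nz]) auto

  have ineq: "?p x \<ge> 0" if x: "x \<in> S" for x
  proof -
    have "(\<Sum>j\<in>{0..m}. poly_eval (g j) x * ?K j x) \<le> (\<Sum>j\<in>{0..m}. real (s (n - r j)))"
    proof (rule sum_le_of_sum_ln_le)
      fix \<tau> :: real assume \<tau>: "\<tau> > 0"
      have t: "0 \<le> \<tau> / (1 + \<tau>)" "\<tau> / (1 + \<tau>) \<le> 1" using \<tau> by auto
      obtain \<phi> where \<phi>: "\<phi> \<in> borel_prob_measures S"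
        and mix: "\<And>h. continuous_on UNIV h \<Longrightarrow>
          (\<integral>y. h y \<partial>\<phi>) = (1 - \<tau> / (1 + \<tau>)) * (\<integral>y. h y \<partial>\<mu>) + \<tau> / (1 + \<tau>) * h x"
        using borel_prob_measures_mix_point[OF S\<mu> x t] by blast
      have d\<phi>: "?d \<phi> j = (1 / (1 + \<tau>)) ^ s (n - r j) * (?d \<mu> j * (1 + \<tau> * (poly_eval (g j) x * ?K j x)))"
        if "j \<le> m" for j
        unfolding len[symmetric] by (rule det_moment_matrix_mix_point[OF S\<mu> x \<tau> d_nz[OF that] mix])
      \<comment> \<open>makes the logarithm of each factor of \<open>d\<phi>\<close> split, and the objective at \<open>\<phi>\<close> finite\<close>
      have f_pos: "1 + \<tau> * (poly_eval (g j) x * ?K j x) > 0" if "j \<le> m" for j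
        using mult_nonneg_nonneg[OF less_imp_le[OF \<tau>] a_nonneg[OF that x]] by linarith
      have d\<phi>_pos: "?d \<phi> j > 0" if "j \<le> m" for j
        unfolding d\<phi>[OF that] using \<tau> d_pos[OF that] f_pos[OF that] by simp
      have ln_d\<phi>: "ln (?d \<phi> j) = ln (?d \<mu> j) + ln (1 + \<tau> * (poly_eval (g j) x * ?K j x))
          - real (s (n - r j)) * ln (1 + \<tau>)" if "j \<le> m" for j
        unfolding d\<phi>[OF that] using \<tau> d_pos[OF that] f_pos[OF that]
        by (simp add: ln_mult ln_realpow ln_div)
      have "(\<Sum>j\<in>{0..m}. ln (?d \<phi> j)) \<le> (\<Sum>j\<in>{0..m}. ln (?d \<mu> j))"
        using opt[OF \<phi>] d_pos d\<phi>_pos by (simp add: obj_eq)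
      also have "(\<Sum>j\<in>{0..m}. ln (?d \<phi> j)) = (\<Sum>j\<in>{0..m}. ln (?d \<mu> j)
          + ln (1 + \<tau> * (poly_eval (g j) x * ?K j x)) - real (s (n - r j)) * ln (1 + \<tau>))"
        using ln_d\<phi> by (intro sum.cong) auto
      finally show "(\<Sum>j\<in>{0..m}. ln (1 + \<tau> * (poly_eval (g j) x * ?K j x)))
          \<le> (\<Sum>j\<in>{0..m}. real (s (n - r j))) * ln (1 + \<tau>)"
        by (simp add: sum.distrib sum_subtractf sum_distrib_right)
    qed
    then show ?thesis by simp
  qed

  have poly_a: "real_polynomial_function (\<lambda>x. poly_eval (g j) x * ?K j x)" if "j \<le> m" for j
    by (intro real_polynomial_function.intros(4) real_polynomial_function_poly_eval
        real_polynomial_function_cd_kernel d_nz[OF that])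
  have poly_p: "real_polynomial_function ?p"
    by (intro real_polynomial_function_diff real_polynomial_function.intros(2)
        real_polynomial_function_sum poly_a) auto
  interpret prob_space \<mu> using \<mu> by (simp add: borel_prob_measures_def)
  have "(\<integral>x. ?p x \<partial>\<mu>) = (\<Sum>j\<in>{0..m}. real (s (n - r j))) - (\<Sum>j\<in>{0..m}. \<integral>x. poly_eval (g j) x * ?K j x \<partial>\<mu>)"
    using integrable_polynomial[OF S\<mu> poly_a] by (subst Bochner_Integration.integral_diff) (auto simp: prob_space)
  also have "\<dots> = 0"
    using integral_cd_kernel[OF S\<mu> d_nz] by (simp add: len)
  finally have "(\<integral>x. ?p x \<partial>\<mu>) = 0" .
  moreover have "AE x in \<mu>. 0 \<le> ?p x"
    using ineq space_borel_prob_measures[OF \<mu>] by (intro AE_I2) auto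
  ultimately have ae: "AE x in \<mu>. ?p x = 0"
    using integral_nonneg_eq_0_iff_AE[OF integrable_polynomial[OF S\<mu> poly_p]] by blast

  have "?p x = 0"
    if f: "f \<in> borel_measurable (restrict_space borel S)" "\<forall>x\<in>S. f x > 0"
      and \<mu>_f: "\<mu> = density (restrict_space lborel S) (\<lambda>x. ennreal (f x))" for f x
  proof -
    have S_sets: "S \<in> sets lborel" using \<open>compact S\<close> by (simp add: borel_compact)
    have "(\<lambda>x. ennreal (f x)) \<in> borel_measurable (restrict_space borel S)"
      using f(1) by measurable
    then have f_meas: "(\<lambda>x. ennreal (f x)) \<in> borel_measurable (restrict_space lborel S)"
      by (simp cong: measurable_cong_sets sets_restrict_space_cong)
    have "AE x in restrict_space lborel S. 0 < ennreal (f x) \<longrightarrow> ?p x = 0"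
      using ae unfolding AE_density[OF f_meas, folded \<mu>_f] .
    then have "AE x in lborel. x \<in> S \<longrightarrow> 0 < ennreal (f x) \<longrightarrow> ?p x = 0"
      using S_sets by (subst (asm) AE_restrict_space_iff) auto
    then have ae_S: "AE x in lborel. x \<in> S \<longrightarrow> ?p x = 0"
      by eventually_elim (use f(2) in auto)
    have "continuous_on UNIV ?p"
      using poly_p by (simp add: real_polynomial_function_eq continuous_on_polymonial_function)
    from zero_on_interior_of_AE[OF this ae_S]
    show ?thesis
      by (rule real_polynomial_function_zero_on_open[OF poly_p open_interior \<open>interior S \<noteq> {}\<close>])
  qed
  then show ?thesis using ineq ae by auto
qed

end
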